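(* Let $p,q\in[1,\infty]$ be Hölder conjugates, i.e. $\frac1p+\frac1q=1$, and let $d,N\in\mathbb{N}$. For every point set $\mathcal{P}=\{\boldsymbol{x}_1,\ldots,\boldsymbol{x}_N\}$ in $[0,1)^d$ and arbitrary corresponding real weights $\mathcal{A}=\{c_1,\ldots,c_N\}$ we have $$e(Q_{\mathcal{P},\mathcal{A}};F_{d,q})=L_{p,N}^{\mathrm{ext}}(\mathcal{P},\mathcal{A}).$$
   Context: Let $\mathbb{D}_d:=\{(\boldsymbol{a},\boldsymbol{b})\in[0,1]^d\times[0,1]^d:\ a_j\le b_j \text{ for all } j\}$, equipped with $2d$-dimensional Lebesgue measure. For $(\boldsymbol a,\boldsymbol b)\in\mathbb{D}_d$ let $[\boldsymbol a,\boldsymbol b)=\prod_{j=1}^d[a_j,b_j)$ and $[\boldsymbol a,\boldsymbol b]=\prod_{j=1}^d[a_j,b_j]$; $\mathbf{1}_C$ denotes the indicator function of $C$. Discrepancy. For points $\mathcal{P}=\{\boldsymbol{x}_1,\ldots,\boldsymbol{x}_N\}\subset[0,1)^d$ and real weights $\mathcal{A}=\{c_1,\ldots,c_N\}$ (with $c_k$ belonging to $\boldsymbol x_k$) put $$\Delta_{\mathcal{P},\mathcal{A}}([\boldsymbol a,\boldsymbol b))=\sum_{k=1}^N c_k\,\mathbf{1}_{[\boldsymbol a,\boldsymbol b)}(\boldsymbol x_k)-\prod_{j=1}^d(b_j-a_j).$$ The generalized extreme $L_p$ discrepancy is $$L_{p,N}^{\mathrm{ext}}(\mathcal{P},\mathcal{A})=\left(\int_{\mathbb{D}_d}|\Delta_{\mathcal{P},\mathcal{A}}([\boldsymbol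 a,\boldsymbol b))|^p\,\mathrm{d}(\boldsymbol a,\boldsymbol b)\right)^{1/p}\quad(1\le p<\infty),$$ and for $p=\infty$ it is the $L_\infty(\mathbb{D}_d)$-norm (essential supremum over $\mathbb{D}_d$) of $(\boldsymbol a,\boldsymbol b)\mapsto\Delta_{\mathcal{P},\mathcal{A}}([\boldsymbol a,\boldsymbol b))$. Function space. For $c\in L_q(\mathbb{D}_d)$ define, for $\boldsymbol x\in[0,1]^d$, $(T_dc)(\boldsymbol x):=\int_{\mathbb{D}_d}c(\boldsymbol a,\boldsymbol b)\,\mathbf{1}_{[\boldsymbol a,\boldsymbol b]}(\boldsymbol x)\,\mathrm{d}(\boldsymbol a,\boldsymbol b)$. Let $F_{d,q}:=\{T_dc:\ c\in L_q(\mathbb{D}_d)\}$ with norm $\|f\|_{F_{d,q},\mathrm{box}}:=\inf\{\|c\|_{L_q(\mathbb{D}_d)}:\ c\in L_q(\mathbb{D}_d),\ f=T_dc\}$. Integration. For $f\in F_{d,q}$ let $I(f):=\int_{[0,1]^d}f(\boldsymbol x)\,\mathrm{d}\boldsymbol x$ and $Q_{\mathcal{P},\mathcal{A}}(f):=\sum_{k=1}^Nc_kf(\boldsymbol x_k)$. The worst-case error is $$e(Q_{\mathcal{P},\mathcal{A}};F_{d,q}):=\sup_{\|f\|_{F_{d,q},\mathrm{box}}\le1}|I(f)-Q_{\mathcal{P},\mathcal{A}}(f)|.$$ *)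

theory Defs
  imports "HOL-Probability.Essential_Supremum"
begin

text \<open>The \<open>L\<^sub>p\<close>-norm for \<open>p \<in> [1, \<infinity>]\<close>, valued in \<open>[0, \<infinity>]\<close>.  There is no \<open>powr\<close> on
  \<^typ>\<open>ennreal\<close>, so the outer power \<open>1/p\<close> is taken on the reals when the integral is finite.\<close>

definition Lp_norm :: "ennreal \<Rightarrow> 'a measure \<Rightarrow> ('a \<Rightarrow> real) \<Rightarrow> ennreal" where
  "Lp_norm p M g =
     (if p = \<infinity> then esssup M (\<lambda>x. ennreal \<bar>g x\<bar>)
      else let J = (\<integral>\<^sup>+x. ennreal (\<bar>g x\<bar> powr enn2real p) \<partial>M)
           in if J = \<infinity> then \<infinity> else ennreal (enn2real J powr (1 / enn2real p)))"

definition Lp_set :: "ennreal \<Rightarrow> 'a measure \<Rightarrow> ('a \<Rightarrow> real) set" where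
  "Lp_set p M = {g \<in> borel_measurable M. Lp_norm p M g < \<infinity>}"

definition DD :: "((real ^ 'd) \<times> (real ^ 'd)) set" where
  "DD = {(a, b). a \<in> cbox 0 1 \<and> b \<in> cbox 0 1 \<and> (\<forall>j. a $ j \<le> b $ j)}"

definition half_open_box :: "real ^ 'd \<Rightarrow> real ^ 'd \<Rightarrow> (real ^ 'd) set" where
  "half_open_box a b = {x. \<forall>j. a $ j \<le> x $ j \<and> x $ j < b $ j}"

text \<open>Points and weights are families indexed by \<open>{1..N}\<close>; repeated points are allowed.\<close>

definition local_discrepancy ::
  "nat \<Rightarrow> (nat \<Rightarrow> real ^ 'd) \<Rightarrow> (nat \<Rightarrow> real) \<Rightarrow> (real ^ 'd) \<times> (real ^ 'd) \<Rightarrow> real" where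
  "local_discrepancy N x c = (\<lambda>(a, b).
     (\<Sum>k = 1..N. c k * indicator (half_open_box a b) (x k)) - (\<Prod>j\<in>UNIV. b $ j - a $ j))"

definition extreme_discrepancy ::
  "ennreal \<Rightarrow> nat \<Rightarrow> (nat \<Rightarrow> real ^ 'd) \<Rightarrow> (nat \<Rightarrow> real) \<Rightarrow> ennreal" where
  "extreme_discrepancy p N x c = Lp_norm p (lebesgue_on DD) (local_discrepancy N x c)"

text \<open>\<open>box_op g\<close> is a total function, but it vanishes outside the unit cube because
  \<open>cbox a b \<subseteq> cbox 0 1\<close> for \<open>(a, b) \<in> DD\<close>.  Equality of such functions is therefore the same as
  pointwise equality on the unit cube.\<close>

definition box_op :: "((real ^ 'd) \<times> (real ^ 'd) \<Rightarrow> real) \<Rightarrow> real ^ 'd \<Rightarrow> real" where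
  "box_op g x = (LINT (a, b)|lebesgue_on DD. g (a, b) * indicator (cbox a b) x)"

definition box_space :: "ennreal \<Rightarrow> (real ^ 'd \<Rightarrow> real) set" where
  "box_space q = {box_op g | g. g \<in> Lp_set q (lebesgue_on DD)}"

definition box_norm :: "ennreal \<Rightarrow> (real ^ 'd \<Rightarrow> real) \<Rightarrow> ennreal" where
  "box_norm q f =
     Inf {Lp_norm q (lebesgue_on DD) g | g. g \<in> Lp_set q (lebesgue_on DD) \<and> f = box_op g}"

definition cube_integral :: "(real ^ 'd \<Rightarrow> real) \<Rightarrow> real" where
  "cube_integral f = (LINT x|lebesgue_on (cbox 0 1). f x)"

definition quadrature ::
  "nat \<Rightarrow> (nat \<Rightarrow> real ^ 'd) \<Rightarrow> (nat \<Rightarrow> real) \<Rightarrow> (real ^ 'd \<Rightarrow> real) \<Rightarrow> real" where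
  "quadrature N x c f = (\<Sum>k = 1..N. c k * f (x k))"

text \<open>The supremum is taken in \<^typ>\<open>ennreal\<close>, so that it is meaningful without a boundedness proof.\<close>

definition worst_case_error ::
  "ennreal \<Rightarrow> nat \<Rightarrow> (nat \<Rightarrow> real ^ 'd) \<Rightarrow> (nat \<Rightarrow> real) \<Rightarrow> ennreal" where
  "worst_case_error q N x c =
     (SUP f\<in>{f \<in> box_space q. box_norm q f \<le> 1}. ennreal \<bar>cube_integral f - quadrature N x c f\<bar>)"

end

theory Submission
  imports Defs
begin

text \<open>Integrating \<open>box_op g\<close> over the cube and exchanging the two integrals turns the
  indicator of \<open>cbox a b\<close> into the volume \<open>\<Prod>j. b $ j - a $ j\<close>, while evaluating
  \<open>box_op g\<close> at the nodes turns it into the weighted count of nodes in \<open>cbox a b\<close>.  The error of the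
  quadrature rule on \<open>box_op g\<close> is therefore \<open>- \<integral> g \<Delta>\<close> over \<open>DD\<close>, where \<open>\<Delta>\<close> is the local
  discrepancy (\<open>quadrature_error_box_op\<close>).  The local discrepancy counts nodes in half-open boxes;
  that makes no difference under the integral, as a given node lies on the upper boundary of
  \<open>cbox a b\<close> only for a null set of pairs \<open>(a, b)\<close>.

  The theorem is thus the duality of \<open>L\<^sub>p\<close> and \<open>L\<^sub>q\<close> on the finite measure space \<open>DD\<close>.  Hoelder's
  inequality bounds the error on \<open>f\<close> by \<open>\<parallel>g\<parallel>\<^sub>q \<parallel>\<Delta>\<parallel>\<^sub>p\<close> for every representation \<open>f = box_op g\<close>,
  hence by \<open>box_norm q f\<close> times the extreme discrepancy (\<open>quadrature_error_le\<close>).  Conversely, as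
  \<open>\<Delta>\<close> is bounded, functions \<open>g\<close> in the unit ball of \<open>L\<^sub>q\<close> can be found for which \<open>\<integral> g \<Delta>\<close> comes
  as close to \<open>\<parallel>\<Delta>\<parallel>\<^sub>p\<close> as desired (\<open>norming_function\<close>).\<close>

section \<open>Duality of \<open>L\<^sub>p\<close> and \<open>L\<^sub>q\<close>\<close>

text \<open>The definition of \<open>Lp_norm\<close> treats \<open>p = \<infinity>\<close> separately, and Young's inequality is about
  real exponents above 1, so conjugacy in \<^typ>\<open>ennreal\<close> is split into the two endpoint cases and
  the case of real exponents.\<close>

lemma conjugate_exponent_cases:
  fixes p q :: ennreal
  assumes "1 / p + 1 / q = 1"
  obtains (infinity_one) "p = \<infinity>" "q = 1"
    | (one_infinity) "p = 1" "q = \<infinity>"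
    | (finite) P Q where "p = ennreal P" "q = ennreal Q" "1 < P" "1 < Q" "1 / P + 1 / Q = 1"
proof -
  have inv: "r = 1" if "1 / r = 1" for r :: ennreal
  proof (cases r)
    case (real a)
    with that show ?thesis
      by (cases "a = 0") (auto simp: divide_ennreal simp flip: ennreal_1)
  qed (use that in simp)
  consider "p = top" | "q = top" | "p \<noteq> top" "q \<noteq> top" by blast
  then show thesis
  proof cases
    case 1
    with assms inv[of q] show thesis by (intro infinity_one) auto
  next
    case 2
    with assms inv[of p] show thesis by (intro one_infinity) auto
  next
    case 3
    then obtain P Q where PQ: "p = ennreal P" "0 \<le> P" "q = ennreal Q" "0 \<le> Q"
      by (metis ennreal_cases)
    have "P \<noteq> 0" "Q \<noteq> 0"
      using assms PQ by (auto simp: ennreal_divide_zero)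
    with PQ have pos: "0 < P" "0 < Q" by auto
    have "ennreal (1 / P + 1 / Q) = 1"
      using assms PQ pos
      by (simp add: divide_ennreal ennreal_plus flip: ennreal_1)
    then have eq: "1 / P + 1 / Q = 1"
      using pos by (simp only: ennreal_eq_1)
    moreover have "0 < 1 / P" "0 < 1 / Q" using pos by auto
    ultimately have "1 / P < 1" "1 / Q < 1" by linarith+
    then have "1 < P" "1 < Q" using pos by auto
    with PQ eq show thesis by (intro finite) auto
  qed
qed

lemma Lp_norm_infinity: "Lp_norm \<infinity> M f = esssup M (\<lambda>x. ennreal \<bar>f x\<bar>)"
  by (simp add: Lp_norm_def)

lemma Lp_norm_one: "Lp_norm 1 M f = (\<integral>\<^sup>+x. ennreal \<bar>f x\<bar> \<partial>M)"
  by (simp add: Lp_norm_def Let_def less_top)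

text \<open>For a finite exponent the norm hides the integral under a root.  This lemma and the next recover
  the integral from the norm and bound the norm by way of the integral.\<close>

lemma nn_integral_powr_eq_Lp_norm:
  assumes "0 < P" "0 \<le> A" "Lp_norm (ennreal P) M f = ennreal A"
  shows "(\<integral>\<^sup>+x. ennreal (\<bar>f x\<bar> powr P) \<partial>M) = ennreal (A powr P)"
  using assms
  by (cases "\<integral>\<^sup>+x. ennreal (\<bar>f x\<bar> powr P) \<partial>M")
     (auto simp: Lp_norm_def Let_def powr_powr split: if_splits)

lemma Lp_norm_leI:
  assumes "0 < P" "0 \<le> A" "(\<integral>\<^sup>+x. ennreal (\<bar>f x\<bar> powr P) \<partial>M) \<le> ennreal (A powr P)"
  shows "Lp_norm (ennreal P) M f \<le> ennreal A"
proof (cases "\<integral>\<^sup>+x. ennreal (\<bar>f x\<bar> powr P) \<partial>M")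
  case (real r)
  then have "r \<le> A powr P" using assms by simp
  then have "r powr (1 / P) \<le> (A powr P) powr (1 / P)"
    using real assms by (intro powr_mono2) auto
  then show ?thesis using real assms by (simp add: Lp_norm_def Let_def powr_powr)
next
  case top
  with assms show ?thesis by (simp add: top_unique)
qed

lemma (in finite_measure) bounded_in_Lp_set:
  assumes [measurable]: "f \<in> borel_measurable M" and bound: "\<And>x. x \<in> space M \<Longrightarrow> \<bar>f x\<bar> \<le> B"
  shows "f \<in> Lp_set p M"
proof -
  have "(\<integral>\<^sup>+x. ennreal (\<bar>f x\<bar> powr P) \<partial>M) < \<infinity>" if "0 \<le> P" for P
  proof -
    have "(\<integral>\<^sup>+x. ennreal (\<bar>f x\<bar> powr P) \<partial>M) \<le> (\<integral>\<^sup>+x. ennreal (B powr P) \<partial>M)"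
      using bound that by (intro nn_integral_mono ennreal_leI powr_mono2) auto
    also have "\<dots> < \<infinity>"
      by (simp add: emeasure_eq_measure flip: ennreal_mult)
    finally show ?thesis .
  qed
  moreover have "esssup M (\<lambda>x. ennreal \<bar>f x\<bar>) \<le> ennreal B"
    using bound by (intro esssup_I AE_I2 ennreal_leI) auto
  then have "esssup M (\<lambda>x. ennreal \<bar>f x\<bar>) < \<infinity>"
    by (rule le_less_trans) simp
  ultimately show ?thesis
    by (auto simp: Lp_set_def Lp_norm_def Let_def less_top[symmetric])
qed

lemma nn_integral_mult_le_esssup:
  assumes [measurable]: "f \<in> borel_measurable M" "g \<in> borel_measurable M"
  shows "(\<integral>\<^sup>+x. ennreal \<bar>f x * g x\<bar> \<partial>M) \<le> Lp_norm \<infinity> M f * Lp_norm 1 M g"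
proof -
  have "(\<integral>\<^sup>+x. ennreal \<bar>f x * g x\<bar> \<partial>M) \<le> (\<integral>\<^sup>+x. esssup M (\<lambda>x. ennreal \<bar>f x\<bar>) * ennreal \<bar>g x\<bar> \<partial>M)"
    using esssup_AE[where M = M and f = "\<lambda>x. ennreal \<bar>f x\<bar>"]
    by (intro nn_integral_mono_AE) (auto simp: abs_mult ennreal_mult intro!: mult_right_mono)
  also have "\<dots> = Lp_norm \<infinity> M f * Lp_norm 1 M g"
    by (simp only: Lp_norm_infinity Lp_norm_one) (simp add: nn_integral_cmult)
  finally show ?thesis .
qed

text \<open>The bounds \<open>A\<close> and \<open>B\<close> are strictly positive upper bounds of the norms instead of the norms
  themselves, so that dividing by them is harmless also for functions that vanish almost everywhere.\<close>

lemma nn_integral_mult_le_of_powr: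
  fixes P Q A B :: real
  assumes [measurable]: "f \<in> borel_measurable M" "g \<in> borel_measurable M"
    and PQ: "1 < P" "1 < Q" "1 / P + 1 / Q = 1" and AB: "0 < A" "0 < B"
    and f: "(\<integral>\<^sup>+x. ennreal (\<bar>f x\<bar> powr P) \<partial>M) \<le> ennreal (A powr P)"
    and g: "(\<integral>\<^sup>+x. ennreal (\<bar>g x\<bar> powr Q) \<partial>M) \<le> ennreal (B powr Q)"
  shows "(\<integral>\<^sup>+x. ennreal \<bar>f x * g x\<bar> \<partial>M) \<le> ennreal (A * B)"
proof -
  \<comment> \<open>Young's inequality for \<open>\<bar>f x\<bar> / A\<close> and \<open>\<bar>g x\<bar> / B\<close>, multiplied by \<open>A * B\<close>, has these coefficients.\<close>
  define s where "s = A * B / (P * A powr P)"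
  define t where "t = A * B / (Q * B powr Q)"
  have st: "0 \<le> s" "0 \<le> t" using PQ AB by (auto simp: s_def t_def)
  have young: "\<bar>f x * g x\<bar> \<le> s * \<bar>f x\<bar> powr P + t * \<bar>g x\<bar> powr Q" for x
  proof -
    have "(\<bar>f x\<bar> / A) * (\<bar>g x\<bar> / B) \<le> (\<bar>f x\<bar> / A) powr P / P + (\<bar>g x\<bar> / B) powr Q / Q"
      using PQ AB by (intro Youngs_inequality) auto
    then have "A * B * ((\<bar>f x\<bar> / A) * (\<bar>g x\<bar> / B)) \<le> A * B * ((\<bar>f x\<bar> / A) powr P / P + (\<bar>g x\<bar> / B) powr Q / Q)"
      using AB by (intro mult_left_mono) auto
    moreover have "A * B * ((\<bar>f x\<bar> / A) * (\<bar>g x\<bar> / B)) = \<bar>f x * g x\<bar>"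
      using AB by (simp add: abs_mult)
    moreover have "A * B * ((\<bar>f x\<bar> / A) powr P / P + (\<bar>g x\<bar> / B) powr Q / Q)
        = s * \<bar>f x\<bar> powr P + t * \<bar>g x\<bar> powr Q"
      using AB PQ by (simp add: powr_divide s_def t_def distrib_left mult_ac)
    ultimately show ?thesis by simp
  qed
  have "(\<integral>\<^sup>+x. ennreal \<bar>f x * g x\<bar> \<partial>M)
      \<le> (\<integral>\<^sup>+x. ennreal s * ennreal (\<bar>f x\<bar> powr P) + ennreal t * ennreal (\<bar>g x\<bar> powr Q) \<partial>M)"
    using st young by (intro nn_integral_mono) (simp flip: ennreal_mult ennreal_plus)
  also have "\<dots> = ennreal s * (\<integral>\<^sup>+x. ennreal (\<bar>f x\<bar> powr P) \<partial>M) + ennreal t * (\<integral>\<^sup>+x. ennreal (\<bar>g x\<bar> powr Q) \<partial>M)"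
    by (simp add: nn_integral_add nn_integral_cmult)
  also have "\<dots> \<le> ennreal s * ennreal (A powr P) + ennreal t * ennreal (B powr Q)"
    using f g by (intro add_mono mult_left_mono) auto
  also have "\<dots> = ennreal (s * A powr P + t * B powr Q)"
    using st by (simp add: ennreal_mult ennreal_plus)
  also have "s * A powr P + t * B powr Q = A * B * (1 / P + 1 / Q)"
    using PQ(1,2) AB by (simp add: s_def t_def distrib_left)
  finally show ?thesis using PQ(3) by simp
qed

lemma Hoelder_inequality:
  assumes pq: "1 / p + 1 / q = 1" and f: "f \<in> Lp_set p M" and g: "g \<in> Lp_set q M"
  shows "(\<integral>\<^sup>+x. ennreal \<bar>f x * g x\<bar> \<partial>M) \<le> Lp_norm p M f * Lp_norm q M g"
proof -
  have [measurable]: "f \<in> borel_measurable M" "g \<in> borel_measurable M"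
    using f g by (auto simp: Lp_set_def)
  from pq show ?thesis
  proof (cases rule: conjugate_exponent_cases)
    case infinity_one
    then show ?thesis using nn_integral_mult_le_esssup[of f M g] by simp
  next
    case one_infinity
    then show ?thesis using nn_integral_mult_le_esssup[of g M f] by (simp add: mult.commute)
  next
    case (finite P Q)
    obtain A B where A: "0 \<le> A" "Lp_norm p M f = ennreal A" and B: "0 \<le> B" "Lp_norm q M g = ennreal B"
      using f g by (auto simp: Lp_set_def less_top[symmetric]) (metis ennreal_cases)
    \<comment> \<open>The norms \<open>A\<close> and \<open>B\<close> may vanish: enlarge both by \<open>e > 0\<close>, then let \<open>e\<close> tend to 0.\<close>
    have f_le: "(\<integral>\<^sup>+x. ennreal (\<bar>f x\<bar> powr P) \<partial>M) \<le> ennreal ((A + e) powr P)" if "0 < e" for e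
      using nn_integral_powr_eq_Lp_norm[of P A M f] finite A that by (auto intro!: ennreal_leI powr_mono2)
    have g_le: "(\<integral>\<^sup>+x. ennreal (\<bar>g x\<bar> powr Q) \<partial>M) \<le> ennreal ((B + e) powr Q)" if "0 < e" for e
      using nn_integral_powr_eq_Lp_norm[of Q B M g] finite B that by (auto intro!: ennreal_leI powr_mono2)
    have "(\<integral>\<^sup>+x. ennreal \<bar>f x * g x\<bar> \<partial>M) \<le> ennreal ((A + e) * (B + e))" if "0 < e" for e
      using finite A B that
      by (intro nn_integral_mult_le_of_powr[OF _ _ finite(3-5) _ _ f_le[OF that] g_le[OF that]]) auto
    then have ev: "\<forall>\<^sub>F e in at_right 0. (\<integral>\<^sup>+x. ennreal \<bar>f x * g x\<bar> \<partial>M) \<le> ennreal ((A + e) * (B + e))"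
      by (auto intro!: eventually_at_right_less[THEN eventually_mono])
    have "((\<lambda>e. (A + e) * (B + e)) \<longlongrightarrow> (A + 0) * (B + 0)) (at_right 0)"
      by (intro tendsto_intros)
    then have "((\<lambda>e. ennreal ((A + e) * (B + e))) \<longlongrightarrow> ennreal (A * B)) (at_right 0)"
      by (auto intro: tendsto_ennrealI)
    from tendsto_lowerbound[OF this ev] show ?thesis
      using A B by (simp add: ennreal_mult)
  qed
qed

lemma integrable_mult_Lp:
  assumes "1 / p + 1 / q = 1" "f \<in> Lp_set p M" "g \<in> Lp_set q M"
  shows "integrable M (\<lambda>x. f x * g x)"
proof -
  have [measurable]: "f \<in> borel_measurable M" "g \<in> borel_measurable M"
    using assms by (auto simp: Lp_set_def)
  have "Lp_norm p M f * Lp_norm q M g < \<infinity>"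
    using assms by (simp add: Lp_set_def ennreal_mult_less_top)
  with Hoelder_inequality[OF assms] have "(\<integral>\<^sup>+x. ennreal \<bar>f x * g x\<bar> \<partial>M) < \<infinity>"
    by (rule le_less_trans)
  then show ?thesis by (intro integrableI_bounded) auto
qed

lemma abs_integral_mult_le:
  assumes "1 / p + 1 / q = 1" "f \<in> Lp_set p M" "g \<in> Lp_set q M"
  shows "ennreal \<bar>\<integral>x. f x * g x \<partial>M\<bar> \<le> Lp_norm p M f * Lp_norm q M g"
proof -
  have "ennreal \<bar>\<integral>x. f x * g x \<partial>M\<bar> \<le> (\<integral>\<^sup>+x. ennreal \<bar>f x * g x\<bar> \<partial>M)"
    using integral_norm_bound_ennreal[OF integrable_mult_Lp[OF assms]] by simp
  also note Hoelder_inequality[OF assms]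
  finally show ?thesis .
qed

text \<open>The equality case of Hoelder's inequality: \<open>g\<close> should have the sign of \<open>u\<close>, and
  \<open>\<bar>g\<bar>\<^sup>q\<close> should be proportional to \<open>\<bar>u\<bar>\<^sup>p\<close>.  For \<open>p = \<infinity>\<close> the norm need not be attained;
  then the mass of \<open>g\<close> is spread over the set where \<open>\<bar>u\<bar> > t\<close>.  This set has positive measure, and
  the finiteness of the measure makes it possible to normalise.\<close>

lemma (in finite_measure) norming_function:
  assumes pq: "1 / p + 1 / q = 1" and u: "u \<in> Lp_set p M" and t: "t < Lp_norm p M u"
  shows "\<exists>g \<in> Lp_set q M. Lp_norm q M g \<le> 1 \<and> t \<le> ennreal (\<integral>x. g x * u x \<partial>M)"
proof -
  have [measurable]: "u \<in> borel_measurable M"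
    using u by (simp add: Lp_set_def)
  have mem: "g \<in> Lp_set q M" if "g \<in> borel_measurable M" "Lp_norm q M g \<le> 1" for g
    using that le_less_trans[OF that(2), of \<infinity>] by (simp add: Lp_set_def)
  from pq show ?thesis
  proof (cases rule: conjugate_exponent_cases)
    case infinity_one
    define A where "A = {x \<in> space M. t < ennreal \<bar>u x\<bar>}"
    have [measurable]: "A \<in> sets M" unfolding A_def by measurable
    have "0 < emeasure M A"
      unfolding A_def using t[unfolded infinity_one Lp_norm_infinity] by (intro esssup_pos_measure) auto
    then have m: "0 < measure M A"
      by (simp add: emeasure_eq_measure)
    obtain s where s: "0 \<le> s" "t = ennreal s"
      using t by (cases t) auto
    define g where "g x = sgn (u x) * indicator A x / measure M A" for x
    have [measurable]: "g \<in> borel_measurable M" unfolding g_def by measurable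
    have "Lp_norm q M g \<le> (\<integral>\<^sup>+x. ennreal (1 / measure M A) * indicator A x \<partial>M)"
      unfolding infinity_one Lp_norm_one
      using m by (intro nn_integral_mono) (auto simp: g_def indicator_def abs_mult sgn_if)
    also have "\<dots> = 1"
      using m by (simp add: nn_integral_cmult emeasure_eq_measure flip: ennreal_mult ennreal_1)
    finally have g: "Lp_norm q M g \<le> 1" .
    have "s = (\<integral>x. s / measure M A * indicator A x \<partial>M)"
      using m by simp
    also have "\<dots> \<le> (\<integral>x. g x * u x \<partial>M)"
    proof (rule integral_mono)
      show "integrable M (\<lambda>x. s / measure M A * indicator A x)"
        by (intro integrable_mult_right integrable_real_indicator) (auto simp: less_top[symmetric])
      show "integrable M (\<lambda>x. g x * u x)"
        using integrable_mult_Lp[OF pq u mem[OF _ g]] by (simp add: mult.commute)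
      have "sgn r * r = \<bar>r\<bar>" for r :: real by (simp add: sgn_if)
      then have "g x * u x = \<bar>u x\<bar> * indicator A x / measure M A" for x
        by (simp add: g_def mult_ac)
      moreover have "s \<le> \<bar>u x\<bar>" if "x \<in> A" for x
        using that s by (auto simp: A_def ennreal_less_iff)
      ultimately show "s / measure M A * indicator A x \<le> g x * u x" for x
        using m by (auto simp: indicator_def divide_right_mono)
    qed
    finally show ?thesis
      using g mem[of g] s by (intro bexI[of _ g]) (auto intro: ennreal_leI)
  next
    case one_infinity
    define g where "g x = sgn (u x)" for x
    have [measurable]: "g \<in> borel_measurable M" unfolding g_def by measurable
    have g: "Lp_norm q M g \<le> 1"
      unfolding one_infinity Lp_norm_infinity
      by (intro esssup_I AE_I2) (auto simp: g_def sgn_if)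
    have "integrable M u"
      using u one_infinity by (auto simp: Lp_set_def Lp_norm_one integrable_iff_bounded)
    then have "Lp_norm p M u = ennreal (\<integral>x. \<bar>u x\<bar> \<partial>M)"
      unfolding one_infinity Lp_norm_one by (intro nn_integral_eq_integral) auto
    also have "(\<lambda>x. \<bar>u x\<bar>) = (\<lambda>x. g x * u x)"
      by (auto simp: g_def sgn_if)
    finally show ?thesis
      using t g mem[of g] by (intro bexI[of _ g]) auto
  next
    case (finite P Q)
    obtain n where n: "0 \<le> n" "Lp_norm p M u = ennreal n"
      using u by (auto simp: Lp_set_def less_top[symmetric]) (metis ennreal_cases)
    with t have n0: "0 < n"
      by (cases "n = 0") auto
    have J: "(\<integral>\<^sup>+x. ennreal (\<bar>u x\<bar> powr P) \<partial>M) = ennreal (n powr P)"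
      using finite n by (intro nn_integral_powr_eq_Lp_norm) auto
    have PQ: "(P - 1) * Q = P"
      using finite by (simp add: field_simps)
    define g where "g x = sgn (u x) * \<bar>u x\<bar> powr (P - 1) / n powr (P - 1)" for x
    have [measurable]: "g \<in> borel_measurable M" unfolding g_def by measurable
    have gQ: "\<bar>g x\<bar> powr Q = \<bar>u x\<bar> powr P * (1 / n powr P)" for x
      using n0 finite PQ
      by (cases "u x = 0") (auto simp: g_def abs_mult sgn_if powr_divide powr_powr)
    have "(\<integral>\<^sup>+x. ennreal (\<bar>g x\<bar> powr Q) \<partial>M) = ennreal (n powr P) * ennreal (1 / n powr P)"
      unfolding gQ by (simp add: ennreal_mult nn_integral_multc J del: times_divide_eq_right)
    also have "\<dots> = ennreal (1 powr Q)"
      using n0 by (simp flip: ennreal_mult)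
    finally have g: "Lp_norm q M g \<le> 1"
      using Lp_norm_leI[of Q 1 M g] finite by simp
    have gu: "g x * u x = \<bar>u x\<bar> powr P / n powr (P - 1)" for x
    proof -
      have "g x * u x = (sgn (u x) * u x) * \<bar>u x\<bar> powr (P - 1) / n powr (P - 1)"
        by (simp add: g_def mult_ac)
      also have "sgn (u x) * u x = \<bar>u x\<bar>" by (simp add: sgn_if)
      also have "\<bar>u x\<bar> * \<bar>u x\<bar> powr (P - 1) = \<bar>u x\<bar> powr P"
        by (cases "u x = 0") (simp_all add: powr_diff)
      finally show ?thesis .
    qed
    have "(\<integral>x. \<bar>u x\<bar> powr P \<partial>M) = n powr P"
      using J by (simp add: integral_eq_nn_integral)
    then have "(\<integral>x. g x * u x \<partial>M) = n"
      unfolding gu using n0 by (simp add: powr_diff)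
    then show ?thesis
      using t n g mem[of g] by (intro bexI[of _ g]) auto
  qed
qed

section \<open>Boxes in the unit cube\<close>

lemma compact_DD: "compact (DD :: ((real ^ 'd) \<times> (real ^ 'd)) set)"
proof -
  have eq: "(DD :: ((real ^ 'd) \<times> (real ^ 'd)) set)
      = (cbox 0 1 \<times> cbox 0 1) \<inter> (\<Inter>j. {z. fst z $ j \<le> snd z $ j})"
    by (auto simp: DD_def)
  have "closed (\<Inter>j. {z :: (real ^ 'd) \<times> (real ^ 'd). fst z $ j \<le> snd z $ j})"
    by (intro closed_INT ballI closed_Collect_le continuous_intros)
  then show ?thesis
    unfolding eq by (intro compact_Int_closed compact_Times compact_cbox)
qed

lemma sets_DD [measurable]: "DD \<in> sets borel"
  using compact_DD by (intro borel_closed compact_imp_closed)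

lemma finite_measure_DD: "finite_measure (lebesgue_on DD)"
  by (intro finite_measure_lebesgue_on lmeasurable_compact compact_DD)

lemma cbox_subset_cube_of_DD: "z \<in> DD \<Longrightarrow> cbox (fst z) (snd z) \<subseteq> cbox 0 1"
proof
  fix y assume z: "z \<in> DD" and y: "y \<in> cbox (fst z) (snd z)"
  have "0 \<le> fst z $ j" "fst z $ j \<le> y $ j" "y $ j \<le> snd z $ j" "snd z $ j \<le> 1" for j
    using z y by (auto simp: DD_def mem_box_cart)
  then show "y \<in> cbox 0 1"
    unfolding mem_box_cart by (metis order_trans one_index zero_index)
qed

lemma measure_cbox_of_DD:
  assumes "z \<in> DD"
  shows "measure lborel (cbox (fst z) (snd z)) = (\<Prod>j\<in>UNIV. snd z $ j - fst z $ j)"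
proof -
  have "fst z \<in> cbox (fst z) (snd z)"
    using assms by (auto simp: DD_def mem_box_cart)
  then show ?thesis by (subst content_cbox_cart) auto
qed

lemma measure_cbox_of_DD_le_1:
  assumes "z \<in> DD"
  shows "measure lborel (cbox (fst z) (snd z)) \<le> 1"
  unfolding measure_cbox_of_DD[OF assms]
proof (intro prod_le_1 conjI)
  fix j
  have "0 \<le> fst z $ j" "fst z $ j \<le> snd z $ j" "snd z $ j \<le> 1"
    using assms by (auto simp: DD_def mem_box_cart)
  then show "0 \<le> snd z $ j - fst z $ j" "snd z $ j - fst z $ j \<le> 1" by auto
qed

text \<open>Fubini's theorem needs the indicator to be measurable jointly in the corners of the box and the
  point; the incidence relation is closed.\<close>

lemma borel_measurable_indicator_cbox:
  "(\<lambda>w. indicator (cbox (fst (fst w)) (snd (fst w))) (snd w) :: real)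
     \<in> borel_measurable (borel :: (((real ^ 'd) \<times> (real ^ 'd)) \<times> (real ^ 'd)) measure)"
proof -
  have "closed {w :: ((real ^ 'd) \<times> (real ^ 'd)) \<times> (real ^ 'd).
      \<forall>j. fst (fst w) $ j \<le> snd w $ j \<and> snd w $ j \<le> snd (fst w) $ j}" (is "closed ?S")
    by (intro closed_Collect_all closed_Collect_conj closed_Collect_le continuous_intros)
  then have "(indicator ?S :: _ \<Rightarrow> real) \<in> borel_measurable borel"
    by (intro borel_measurable_indicator borel_closed)
  also have "indicator ?S = (\<lambda>w. indicator (cbox (fst (fst w)) (snd (fst w))) (snd w) :: real)"
    by (auto simp: indicator_def mem_box_cart)
  finally show ?thesis .
qed

lemma borel_measurable_indicator_cbox_section:
  "(\<lambda>z. indicator (cbox (fst z) (snd z)) y :: real)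
     \<in> borel_measurable (borel :: ((real ^ 'd) \<times> (real ^ 'd)) measure)"
  using measurable_compose[OF _ borel_measurable_indicator_cbox, of "\<lambda>z. (z, y)" borel]
  by (simp add: borel_measurable_continuous_onI continuous_intros)

lemma borel_measurable_indicator_half_open_box [measurable]:
  "(\<lambda>z. indicator (half_open_box (fst z) (snd z)) y :: real) \<in> borel_measurable borel"
proof -
  have "{z. \<forall>j. fst z $ j \<le> y $ j \<and> y $ j < snd z $ j} \<in> sets borel" (is "?S \<in> _")
  proof -
    have "?S = (\<Inter>j. {z. fst z $ j \<le> y $ j} \<inter> {z. y $ j < snd z $ j})" by auto
    also have "\<dots> \<in> sets borel"
      by (intro sets.countable_INT'' sets.Int borel_closed borel_open closed_Collect_le open_Collect_less continuous_intros) auto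
    finally show ?thesis .
  qed
  then have "(indicator ?S :: _ \<Rightarrow> real) \<in> borel_measurable borel"
    by (rule borel_measurable_indicator)
  also have "indicator ?S = (\<lambda>z. indicator (half_open_box (fst z) (snd z)) y :: real)"
    by (auto simp: indicator_def half_open_box_def)
  finally show ?thesis .
qed

lemma borel_measurable_lebesgue_onI:
  "f \<in> borel_measurable borel \<Longrightarrow> f \<in> borel_measurable (lebesgue_on S)"
  by (intro measurable_restrict_space1 measurable_completion) simp

lemma local_discrepancy_eq:
  "local_discrepancy N x c z =
     (\<Sum>k = 1..N. c k * indicator (half_open_box (fst z) (snd z)) (x k)) - (\<Prod>j\<in>UNIV. snd z $ j - fst z $ j)"
  by (simp add: local_discrepancy_def split_beta)

lemma borel_measurable_volume [measurable]:
  "(\<lambda>z :: (real ^ 'd) \<times> (real ^ 'd). \<Prod>j\<in>UNIV. snd z $ j - fst z $ j) \<in> borel_measurable borel"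
  by (intro borel_measurable_continuous_onI continuous_intros)

lemma local_discrepancy_in_Lp_set: "local_discrepancy N x c \<in> Lp_set p (lebesgue_on DD)"
proof -
  have "local_discrepancy N x c \<in> borel_measurable (lebesgue_on DD)"
    unfolding local_discrepancy_eq[abs_def] by (intro borel_measurable_lebesgue_onI) measurable
  moreover have "\<bar>local_discrepancy N x c z\<bar> \<le> (\<Sum>k = 1..N. \<bar>c k\<bar>) + 1" if "z \<in> DD" for z
  proof -
    have "\<bar>\<Sum>k = 1..N. c k * indicator (half_open_box (fst z) (snd z)) (x k)\<bar> \<le> (\<Sum>k = 1..N. \<bar>c k\<bar>)"
      by (intro order_trans[OF sum_abs] sum_mono) (auto simp: indicator_def)
    moreover have "0 \<le> (\<Prod>j\<in>UNIV. snd z $ j - fst z $ j)" "(\<Prod>j\<in>UNIV. snd z $ j - fst z $ j) \<le> 1"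
      using measure_cbox_of_DD_le_1[OF that] measure_cbox_of_DD[OF that] measure_nonneg[of lborel "cbox (fst z) (snd z)"]
      by simp_all
    ultimately show ?thesis unfolding local_discrepancy_eq by linarith
  qed
  ultimately show ?thesis
    by (intro finite_measure.bounded_in_Lp_set[OF finite_measure_DD]) auto
qed

text \<open>The two boxes can only differ at \<open>y\<close> if an upper corner lies on one of the hyperplanes
  \<open>b $ j = y $ j\<close>, which are null sets.\<close>

lemma AE_half_open_box_eq_cbox:
  fixes y :: "real ^ 'd"
  shows "AE z in lebesgue_on DD.
    (indicator (half_open_box (fst z) (snd z)) y :: real) = indicator (cbox (fst z) (snd z)) y"
proof -
  have "negligible {z :: (real ^ 'd) \<times> (real ^ 'd). snd z $ j = y $ j}" for j
  proof -
    have "(0, axis j 1) \<in> (Basis :: ((real ^ 'd) \<times> (real ^ 'd)) set)"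
      by (auto simp: Basis_prod_def Basis_vec_def)
    from negligible_standard_hyperplane[OF this, of "y $ j"] show ?thesis
      by (simp add: inner_prod_def inner_axis)
  qed
  then have "negligible (\<Union>j. {z :: (real ^ 'd) \<times> (real ^ 'd). snd z $ j = y $ j})"
    by (intro negligible_Union) auto
  then have "AE z in lebesgue_on DD. z \<notin> (\<Union>j. {z :: (real ^ 'd) \<times> (real ^ 'd). snd z $ j = y $ j})"
    by (subst AE_restrict_space_iff) (auto simp: negligible_iff_null_sets dest!: AE_not_in)
  then show ?thesis
  proof eventually_elim
    case (elim z)
    then have "snd z $ j \<noteq> y $ j" for j by blast
    then have "y $ j \<le> snd z $ j \<longleftrightarrow> y $ j < snd z $ j" for j
      by (metis less_le)
    then show ?case by (simp add: indicator_def half_open_box_def mem_box_cart)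
  qed
qed

text \<open>Lebesgue measure on a product is the completion of the product measure.  Fubini's theorem
  applies to the product measure itself, so functions are first replaced by Borel ones.\<close>

lemma borel_representative_lebesgue_on:
  fixes g :: "'a::euclidean_space \<Rightarrow> real"
  assumes g: "g \<in> borel_measurable (lebesgue_on S)" and S[measurable]: "S \<in> sets borel"
  obtains h where "h \<in> borel_measurable borel" "\<And>z. z \<notin> S \<Longrightarrow> h z = 0" "AE z in lebesgue_on S. g z = h z"
proof -
  have "(\<lambda>z. indicator S z *\<^sub>R g z) \<in> borel_measurable lebesgue"
    using g S by (subst (asm) borel_measurable_restrict_space_iff) auto
  then obtain h where h[measurable]: "h \<in> borel_measurable lborel" and AE: "AE z in lborel. indicator S z *\<^sub>R g z = h z"
    using completion_ex_borel_measurable_real by blast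
  show thesis
  proof
    show "(\<lambda>z. indicator S z * h z) \<in> borel_measurable borel" using h by simp
    show "indicator S z * h z = 0" if "z \<notin> S" for z using that by simp
    from AE_completion[OF AE] show "AE z in lebesgue_on S. g z = indicator S z * h z"
      by (subst AE_restrict_space_iff) (auto elim!: eventually_mono)
  qed
qed

lemma integral_lebesgue_on_borel:
  fixes f :: "'a::euclidean_space \<Rightarrow> real"
  assumes [measurable]: "f \<in> borel_measurable borel" "S \<in> sets borel" and zero: "\<And>z. z \<notin> S \<Longrightarrow> f z = 0"
  shows "(\<integral>z. f z \<partial>lebesgue_on S) = (\<integral>z. f z \<partial>lborel)"
    and "integrable (lebesgue_on S) f \<longleftrightarrow> integrable lborel f"
proof -
  have eq: "(\<lambda>z. indicator S z *\<^sub>R f z) = f"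
    using zero by (intro ext) (auto simp: indicator_def)
  show "(\<integral>z. f z \<partial>lebesgue_on S) = (\<integral>z. f z \<partial>lborel)"
    by (subst integral_restrict_space) (auto simp: eq integral_completion simp del: real_scaleR_def)
  show "integrable (lebesgue_on S) f \<longleftrightarrow> integrable lborel f"
    by (subst integrable_restrict_space) (auto simp: eq integrable_completion simp del: real_scaleR_def)
qed

text \<open>Fubini's theorem: for fixed \<open>z = (a, b)\<close> in \<open>DD\<close> the indicator of \<open>cbox a b\<close> integrates to the
  volume of that box, all of which lies in the unit cube.\<close>

lemma cube_integral_box_op:
  fixes g :: "(real ^ 'd) \<times> (real ^ 'd) \<Rightarrow> real"
  assumes g: "integrable (lebesgue_on DD) g"
  shows "cube_integral (box_op g) = (\<integral>z. g z * (\<Prod>j\<in>UNIV. snd z $ j - fst z $ j) \<partial>lebesgue_on DD)"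
proof -
  have gm [measurable]: "g \<in> borel_measurable (lebesgue_on DD)" using g by simp
  obtain h where h[measurable]: "h \<in> borel_measurable borel" and h0: "\<And>z. z \<notin> DD \<Longrightarrow> h z = 0"
    and AE: "AE z in lebesgue_on DD. g z = h z"
    using borel_representative_lebesgue_on[of g DD] by auto
  have h_int: "integrable lborel h"
    using g integrable_cong_AE[of g "lebesgue_on DD" h] AE integral_lebesgue_on_borel(2)[of h DD] h0
    by (simp add: borel_measurable_lebesgue_onI)
  define F where "F = (\<lambda>z y. h z * indicator (cbox (fst z) (snd z)) y)"
  have F_meas: "case_prod F \<in> borel_measurable borel"
    unfolding F_def split_beta
    by (intro borel_measurable_times borel_measurable_indicator_cbox measurable_compose[OF _ h]
          borel_measurable_continuous_onI continuous_intros)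
  then have F_meas': "case_prod F \<in> borel_measurable (lborel \<Otimes>\<^sub>M lborel)"
    by (simp add: lborel_prod)
  have Fz: "F z \<in> borel_measurable borel" for z
    unfolding F_def by measurable
  have Fy: "(\<lambda>z. F z y) \<in> borel_measurable borel" for y
  proof -
    have "(\<lambda>z. case_prod F (z, y)) \<in> borel_measurable borel"
      by (rule measurable_compose[OF _ F_meas]) (intro borel_measurable_continuous_onI continuous_intros)
    then show ?thesis by simp
  qed
  have box: "box_op g y = (\<integral>z. F z y \<partial>lborel)" for y
  proof -
    have "box_op g y = (\<integral>z. F z y \<partial>lebesgue_on DD)"
      unfolding box_op_def split_beta
    proof (rule integral_cong_AE)
      show "(\<lambda>z. F z y) \<in> borel_measurable (lebesgue_on DD)"
        by (intro borel_measurable_lebesgue_onI Fy)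
      show "(\<lambda>z. g (fst z, snd z) * indicator (cbox (fst z) (snd z)) y) \<in> borel_measurable (lebesgue_on DD)"
        using borel_measurable_times[OF gm borel_measurable_lebesgue_onI[OF borel_measurable_indicator_cbox_section]]
        by simp
      show "AE z in lebesgue_on DD. g (fst z, snd z) * indicator (cbox (fst z) (snd z)) y = F z y"
        using AE by eventually_elim (simp add: F_def)
    qed
    also have "\<dots> = (\<integral>z. F z y \<partial>lborel)"
      using h0 by (intro integral_lebesgue_on_borel(1) Fy) (auto simp: F_def)
    finally show ?thesis .
  qed
  have Fint: "(\<integral>y. F z y \<partial>lborel) = h z * measure lborel (cbox (fst z) (snd z))"
    "(\<integral>y. norm (F z y) \<partial>lborel) = \<bar>h z\<bar> * measure lborel (cbox (fst z) (snd z))" for z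
    by (simp_all add: F_def abs_mult)
  have "integrable (lborel \<Otimes>\<^sub>M lborel) (case_prod F)"
  proof (rule lborel_pair.Fubini_integrable[OF F_meas'])
    show "integrable lborel (\<lambda>z. \<integral>y. norm (case_prod F (z, y)) \<partial>lborel)"
    proof (rule Bochner_Integration.integrable_bound[OF h_int])
      show "(\<lambda>z. \<integral>y. norm (case_prod F (z, y)) \<partial>lborel) \<in> borel_measurable lborel"
        using F_meas' by (intro lborel.borel_measurable_lebesgue_integral) (auto simp: split_beta)
      have "\<bar>h z\<bar> * measure lborel (cbox (fst z) (snd z)) \<le> \<bar>h z\<bar>" for z
        using measure_cbox_of_DD_le_1[of z] h0[of z] by (cases "z \<in> DD") (auto intro: mult_left_le)
      then show "AE z in lborel. norm (\<integral>y. norm (case_prod F (z, y)) \<partial>lborel) \<le> norm (h z)"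
        by (intro AE_I2) (simp add: Fint[simplified] abs_mult)
    qed
    show "AE z in lborel. integrable lborel (\<lambda>y. case_prod F (z, y))"
      by (intro AE_I2) (simp add: F_def integrable_real_indicator less_top[symmetric] emeasure_lborel_cbox_eq)
  qed
  note fubini = lborel_pair.Fubini_integral[OF this]
  \<comment> \<open>\<open>box_op g\<close> vanishes off the unit cube, so restricting the outer integral to it changes nothing.\<close>
  have off: "(\<integral>z. F z y \<partial>lborel) = 0" if "y \<notin> cbox 0 1" for y
  proof -
    have "F z y = 0" for z
      using that h0[of z] cbox_subset_cube_of_DD[of z] by (cases "z \<in> DD") (auto simp: F_def indicator_def)
    then show ?thesis by simp
  qed
  have "cube_integral (box_op g) = (\<integral>y. (\<integral>z. F z y \<partial>lborel) \<partial>lebesgue_on (cbox 0 1))"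
    unfolding cube_integral_def box ..
  also have "\<dots> = (\<integral>y. (\<integral>z. F z y \<partial>lborel) \<partial>lborel)"
  proof (rule integral_lebesgue_on_borel(1)[OF _ _ off])
    have "(\<lambda>y. \<integral>z. F z y \<partial>lborel) \<in> borel_measurable lborel"
      using measurable_pair_swap[OF F_meas']
      by (intro lborel.borel_measurable_lebesgue_integral) (simp add: split_beta)
    then show "(\<lambda>y. \<integral>z. F z y \<partial>lborel) \<in> borel_measurable borel" by simp
  qed auto
  also have "\<dots> = (\<integral>z. h z * measure lborel (cbox (fst z) (snd z)) \<partial>lborel)"
    unfolding fubini Fint ..
  also have "\<dots> = (\<integral>z. h z * (\<Prod>j\<in>UNIV. snd z $ j - fst z $ j) \<partial>lborel)"
  proof (rule Bochner_Integration.integral_cong[OF refl])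
    show "h z * measure lborel (cbox (fst z) (snd z)) = h z * (\<Prod>j\<in>UNIV. snd z $ j - fst z $ j)" for z
      by (cases "z \<in> DD") (simp only: measure_cbox_of_DD, simp add: h0)
  qed
  also have "\<dots> = (\<integral>z. h z * (\<Prod>j\<in>UNIV. snd z $ j - fst z $ j) \<partial>lebesgue_on DD)"
    using h0 by (intro integral_lebesgue_on_borel(1)[symmetric]) auto
  also have "\<dots> = (\<integral>z. g z * (\<Prod>j\<in>UNIV. snd z $ j - fst z $ j) \<partial>lebesgue_on DD)"
  proof (rule integral_cong_AE)
    show "AE z in lebesgue_on DD. h z * (\<Prod>j\<in>UNIV. snd z $ j - fst z $ j) = g z * (\<Prod>j\<in>UNIV. snd z $ j - fst z $ j)"
      using AE by eventually_elim simp
  qed (auto intro!: borel_measurable_times gm borel_measurable_lebesgue_onI[OF h] borel_measurable_lebesgue_onI[OF borel_measurable_volume])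
  finally show ?thesis .
qed

lemma box_op_half_open:
  assumes gm: "g \<in> borel_measurable (lebesgue_on DD)"
  shows "box_op g y = (\<integral>z. g z * indicator (half_open_box (fst z) (snd z)) y \<partial>lebesgue_on DD)"
  unfolding box_op_def split_beta
proof (rule integral_cong_AE)
  show "(\<lambda>z. g (fst z, snd z) * indicator (cbox (fst z) (snd z)) y) \<in> borel_measurable (lebesgue_on DD)"
    using borel_measurable_times[OF gm borel_measurable_lebesgue_onI[OF borel_measurable_indicator_cbox_section]]
    by simp
  show "(\<lambda>z. g z * indicator (half_open_box (fst z) (snd z)) y) \<in> borel_measurable (lebesgue_on DD)"
    by (rule borel_measurable_times[OF gm borel_measurable_lebesgue_onI[OF borel_measurable_indicator_half_open_box]])
  show "AE z in lebesgue_on DD. g (fst z, snd z) * indicator (cbox (fst z) (snd z)) y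
      = g z * indicator (half_open_box (fst z) (snd z)) y"
    using AE_half_open_box_eq_cbox[of y] by eventually_elim simp
qed

text \<open>The link between integration and discrepancy: on functions \<open>box_op g\<close> the error functional is
  integration of \<open>g\<close> against the local discrepancy.\<close>

lemma quadrature_error_box_op:
  assumes g: "integrable (lebesgue_on DD) g"
  shows "cube_integral (box_op g) - quadrature N x c (box_op g)
    = - (\<integral>z. g z * local_discrepancy N x c z \<partial>lebesgue_on DD)"
proof -
  have gm: "g \<in> borel_measurable (lebesgue_on DD)" using g by simp
  have int_half: "integrable (lebesgue_on DD) (\<lambda>z. g z * indicator (half_open_box (fst z) (snd z)) y)" for y
  proof (rule Bochner_Integration.integrable_bound[OF g])
    show "(\<lambda>z. g z * indicator (half_open_box (fst z) (snd z)) y) \<in> borel_measurable (lebesgue_on DD)"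
      by (rule borel_measurable_times[OF gm borel_measurable_lebesgue_onI[OF borel_measurable_indicator_half_open_box]])
  qed (auto simp: indicator_def)
  have "\<bar>g z * (\<Prod>j\<in>UNIV. snd z $ j - fst z $ j)\<bar> \<le> \<bar>g z\<bar>" if "z \<in> DD" for z
    using measure_cbox_of_DD_le_1[OF that] measure_nonneg[of lborel "cbox (fst z) (snd z)"]
    unfolding measure_cbox_of_DD[OF that] abs_mult by (intro mult_left_le) auto
  then have int_vol: "integrable (lebesgue_on DD) (\<lambda>z. g z * (\<Prod>j\<in>UNIV. snd z $ j - fst z $ j))"
    using borel_measurable_times[OF gm borel_measurable_lebesgue_onI[OF borel_measurable_volume]]
    by (intro Bochner_Integration.integrable_bound[OF g] AE_I2) auto
  have "(\<integral>z. g z * local_discrepancy N x c z \<partial>lebesgue_on DD)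
      = (\<integral>z. (\<Sum>k = 1..N. c k * (g z * indicator (half_open_box (fst z) (snd z)) (x k)))
          - g z * (\<Prod>j\<in>UNIV. snd z $ j - fst z $ j) \<partial>lebesgue_on DD)"
    by (intro Bochner_Integration.integral_cong)
       (simp_all only: local_discrepancy_eq right_diff_distrib sum_distrib_left mult.left_commute)
  also have "\<dots> = (\<Sum>k = 1..N. c k * box_op g (x k)) - cube_integral (box_op g)"
    using int_half int_vol
    by (simp add: cube_integral_box_op[OF g] box_op_half_open[OF gm])
  finally show ?thesis by (simp add: quadrature_def)
qed

section \<open>Worst-case error and extreme discrepancy\<close>

context
  fixes p q :: ennreal and N :: nat and x :: "nat \<Rightarrow> real ^ 'd" and c :: "nat \<Rightarrow> real"
  assumes pq: "1 / p + 1 / q = 1"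
begin

lemma quadrature_error_Lp:
  assumes "g \<in> Lp_set q (lebesgue_on DD)"
  shows "\<bar>cube_integral (box_op g) - quadrature N x c (box_op g)\<bar>
    = \<bar>\<integral>z. g z * local_discrepancy N x c z \<partial>lebesgue_on DD\<bar>"
proof -
  \<comment> \<open>On a finite measure space, Hoelder's inequality with the constant 1 puts \<open>L\<^sub>q\<close> inside \<open>L\<^sub>1\<close>.\<close>
  have "(\<lambda>_. 1) \<in> Lp_set p (lebesgue_on DD)"
    by (intro finite_measure.bounded_in_Lp_set[OF finite_measure_DD, of _ 1]) auto
  from integrable_mult_Lp[OF pq this assms] have "integrable (lebesgue_on DD) g"
    by simp
  then show ?thesis by (simp add: quadrature_error_box_op)
qed

text \<open>Hoelder's inequality gives this bound with \<open>Lp_norm q (lebesgue_on DD) g\<close> for each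
  representation \<open>f = box_op g\<close>; dividing by the discrepancy allows the infimum over \<open>g\<close> to be taken.\<close>

lemma quadrature_error_le:
  assumes f: "f \<in> box_space q"
  shows "ennreal \<bar>cube_integral f - quadrature N x c f\<bar> \<le> box_norm q f * extreme_discrepancy p N x c"
    (is "?E \<le> _ * ?D")
proof -
  have le: "?E \<le> Lp_norm q (lebesgue_on DD) g * ?D" if "g \<in> Lp_set q (lebesgue_on DD)" "f = box_op g" for g
    using abs_integral_mult_le[of q p g "lebesgue_on DD" "local_discrepancy N x c"] that pq
    by (simp add: quadrature_error_Lp local_discrepancy_in_Lp_set extreme_discrepancy_def add.commute)
  show ?thesis
  proof (cases "?D = 0")
    case True
    with f le show ?thesis by (auto simp: box_space_def)
  next
    case False
    have "?D \<noteq> \<infinity>"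
      using local_discrepancy_in_Lp_set[of N x c p] by (auto simp: Lp_set_def extreme_discrepancy_def)
    then have D: "?D \<noteq> top" by simp
    have "?E / ?D \<le> box_norm q f"
      unfolding box_norm_def
    proof (rule Inf_greatest, clarify)
      fix g assume "g \<in> Lp_set q (lebesgue_on DD)" "f = box_op g"
      from divide_right_mono_ennreal[OF le[OF this], of ?D]
      show "ennreal \<bar>cube_integral (box_op g) - quadrature N x c (box_op g)\<bar> / ?D \<le> Lp_norm q (lebesgue_on DD) g"
        using False D \<open>f = box_op g\<close> by (simp add: ennreal_mult_divide_eq)
    qed
    then have "?E / ?D * ?D \<le> box_norm q f * ?D" by (rule mult_right_mono) simp
    then show ?thesis using False D
      by (simp add: ennreal_divide_times ennreal_divide_self less_top)
  qed
qed

text \<open>A function \<open>g\<close> in the unit ball of \<open>L\<^sub>q\<close> yields \<open>box_op g\<close> in the unit ball of the box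
  space, so the functions that norm the local discrepancy are admissible in the supremum.\<close>

lemma extreme_discrepancy_le_worst_case_error:
  "extreme_discrepancy p N x c \<le> worst_case_error q N x c"
proof (rule dense_le)
  fix t assume "t < extreme_discrepancy p N x c"
  then obtain g where g: "g \<in> Lp_set q (lebesgue_on DD)" "Lp_norm q (lebesgue_on DD) g \<le> 1"
    and t: "t \<le> ennreal (\<integral>z. g z * local_discrepancy N x c z \<partial>lebesgue_on DD)"
    using finite_measure.norming_function[OF finite_measure_DD pq local_discrepancy_in_Lp_set]
    unfolding extreme_discrepancy_def by blast
  have "box_norm q (box_op g) \<le> Lp_norm q (lebesgue_on DD) g"
    unfolding box_norm_def using g by (intro Inf_lower) auto
  with g have "box_op g \<in> {f \<in> box_space q. box_norm q f \<le> 1}"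
    by (auto simp: box_space_def)
  then have "ennreal \<bar>cube_integral (box_op g) - quadrature N x c (box_op g)\<bar> \<le> worst_case_error q N x c"
    unfolding worst_case_error_def by (rule SUP_upper)
  moreover have "t \<le> ennreal \<bar>cube_integral (box_op g) - quadrature N x c (box_op g)\<bar>"
    unfolding quadrature_error_Lp[OF g(1)] by (rule order_trans[OF t]) (auto intro: ennreal_leI)
  ultimately show "t \<le> worst_case_error q N x c" by simp
qed

end

theorem theorem2:
  fixes p q :: ennreal and N :: nat
    and x :: "nat \<Rightarrow> real ^ 'd" and c :: "nat \<Rightarrow> real"
  assumes "1 \<le> p" and "1 \<le> q" and "1 / p + 1 / q = 1"
    and "1 \<le> N"
    and "\<And>k. k \<in> {1..N} \<Longrightarrow> x k \<in> half_open_box 0 1"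
  shows "worst_case_error q N x c = extreme_discrepancy p N x c"
proof (rule antisym)
  show "extreme_discrepancy p N x c \<le> worst_case_error q N x c"
    by (rule extreme_discrepancy_le_worst_case_error) fact
  show "worst_case_error q N x c \<le> extreme_discrepancy p N x c"
    unfolding worst_case_error_def
  proof (rule SUP_least, clarify)
    fix f :: "real ^ 'd \<Rightarrow> real"
    assume f: "f \<in> box_space q" "box_norm q f \<le> 1"
    have "ennreal \<bar>cube_integral f - quadrature N x c f\<bar> \<le> box_norm q f * extreme_discrepancy p N x c"
      using assms(3) f(1) by (rule quadrature_error_le)
    also have "\<dots> \<le> 1 * extreme_discrepancy p N x c"
      using f(2) by (rule mult_right_mono) simp
    finally show "ennreal \<bar>cube_integral f - quadrature N x c f\<bar> \<le> extreme_discrepancy p N x c"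
      by simp
  qed
qed

end
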